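(* Let $(\Omega,\rightarrow)$ be an associative semigroup with the right inverse condition. Consider the EAS $\Omega'=\mathbf{EAS}(\Omega,\rightarrow)\times\mathbf{EAS}'(\Omega,\rightarrow)$ and denote by $(A',\Phi')$ its linearization. The following defines a surjective morphism of nonsymmetric operads: $$\Theta'_\Omega:\mathbf{As}_\Omega^2\longrightarrow\mathbf{As}_{\Phi'},\qquad *_{\alpha,\beta}\longmapsto *_{(\alpha,\beta)}.$$
   Context: $\mathbb{K}$ is a field. An extended associative semigroup (EAS) is a nonempty set $\Omega$ with maps $\rightarrow,\triangleright:\Omega^2\to\Omega$ such that for all $\alpha,\beta,\gamma$: $\alpha\rightarrow(\beta\rightarrow\gamma)=(\alpha\rightarrow\beta)\rightarrow\gamma$; $(\alpha\triangleright(\beta\rightarrow\gamma))\rightarrow(\beta\triangleright\gamma)=(\alpha\rightarrow\beta)\triangleright\gamma$; $(\alpha\triangleright(\beta\rightarrow\gamma))\triangleright(\beta\triangleright\gamma)=\alpha\triangleright\beta$. A semigroup $(\Omega,\rightarrow)$ satisfies the right inverse condition if for all $\alpha,\beta\in\Omega$ there is a unique $\gamma\in\Omega$, denoted by $\alpha\triangleright\beta$, such that $\gamma\rightarrow\beta=\alpha$ (for a group, $\alpha\triangleright\beta=\alpha\rightarrow\beta^{-1}$). $\mathbf{EAS}(\Omega,\rightarrow)$ is $\Omega$ with first operation $\rightarrow$ and second operation $(\alpha,\beta)\mapsto\alpha$; $\mathbf{EAS}'(\Omega,\rightarrow)$ is $\Omega$ with first operation $(\alpha,\beta)\mapsto\beta$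 and second operation $(\alpha,\beta)\mapsto\alpha\triangleright\beta$. Thus the EAS structure of $\Omega'=\Omega^2$ (componentwise product) is $(\alpha,\beta)\rightarrow(\gamma,\delta)=(\alpha\rightarrow\gamma,\delta)$ and $(\alpha,\beta)\triangleright(\gamma,\delta)=(\alpha,\beta\triangleright\delta)$. The linearization of an EAS $\Omega'$ is $A'=\mathbb{K}\Omega'$ with $\Phi'(p\otimes q)=(p\rightarrow q)\otimes(p\triangleright q)$ for $p,q\in\Omega'$, and $\mathbf{As}_{\Phi'}$ is the nonsymmetric operad generated by binary operations $*_p$, $p\in\Omega'$, with relations $*_p\circ_2 *_q=*_{p\rightarrow q}\circ_1 *_{p\triangleright q}$. $\mathbf{As}_\Omega^2$ is the nonsymmetric operad generated by binary operations $*_{\alpha,\beta}$, $(\alpha,\beta)\in\Omega^2$, with relations $*_{\alpha\rightarrow\beta,\gamma}\circ_1 *_{\alpha,\beta}=*_{\alpha,\beta\rightarrow\gamma}\circ_2 *_{\beta,\gamma}$. *)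

theory Defs
  imports
    "HOL-Algebra.AbelCoset"
    "Jordan_Normal_Form.VS_Connect"
    "HOL-Library.Tree"
    "HOL-Library.Poly_Mapping"
begin

section \<open>Extended associative semigroups\<close>

text \<open>
  All semigroup-like structures live on a whole type, which is automatically nonempty.
\<close>

record 'w eas_ops =
  arr :: "'w \<Rightarrow> 'w \<Rightarrow> 'w"
  tri :: "'w \<Rightarrow> 'w \<Rightarrow> 'w"

locale eas =
  fixes E :: "'w eas_ops"
  assumes arr_assoc: "arr E a (arr E b c) = arr E (arr E a b) c"
    and arr_tri: "arr E (tri E a (arr E b c)) (tri E b c) = tri E (arr E a b) c"
    and tri_tri: "tri E (tri E a (arr E b c)) (tri E b c) = tri E a b"

definition right_inverse_condition :: "('w \<Rightarrow> 'w \<Rightarrow> 'w) \<Rightarrow> bool" where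
  "right_inverse_condition f \<longleftrightarrow> (\<forall>a b. \<exists>!c. f c b = a)"

definition right_div :: "('w \<Rightarrow> 'w \<Rightarrow> 'w) \<Rightarrow> 'w \<Rightarrow> 'w \<Rightarrow> 'w" where
  "right_div f a b = (THE c. f c b = a)"

definition EAS :: "('w \<Rightarrow> 'w \<Rightarrow> 'w) \<Rightarrow> 'w eas_ops" where
  "EAS f = \<lparr>arr = f, tri = (\<lambda>a b. a)\<rparr>"

definition EAS' :: "('w \<Rightarrow> 'w \<Rightarrow> 'w) \<Rightarrow> 'w eas_ops" where
  "EAS' f = \<lparr>arr = (\<lambda>a b. b), tri = right_div f\<rparr>"

definition eas_prod :: "'v eas_ops \<Rightarrow> 'w eas_ops \<Rightarrow> ('v \<times> 'w) eas_ops" where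
  "eas_prod E F =
    \<lparr>arr = (\<lambda>(a, b) (c, d). (arr E a c, arr F b d)),
     tri = (\<lambda>(a, b) (c, d). (tri E a c, tri F b d))\<rparr>"

lemma right_div_mult:
  assumes "right_inverse_condition f"
  shows "f (right_div f a b) b = a"
  using assms unfolding right_inverse_condition_def right_div_def by (rule_tac theI') blast

lemma right_div_eqI:
  assumes "right_inverse_condition f" "f c b = a"
  shows "right_div f a b = c"
  using assms right_div_mult[OF assms(1)] unfolding right_inverse_condition_def by metis

lemma eas_EAS: "semigroup f \<Longrightarrow> eas (EAS f)"
  by unfold_locales (simp_all add: EAS_def semigroup.assoc)

lemma eas_EAS':
  assumes "semigroup f" "right_inverse_condition f"
  shows "eas (EAS' f)"
proof
  fix a b c
  have "f (right_div f (right_div f a c) (right_div f b c)) b = a"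
    using right_div_mult[OF assms(2)] semigroup.assoc[OF assms(1)] by metis
  then have "right_div f (right_div f a c) (right_div f b c) = right_div f a b"
    using right_div_eqI[OF assms(2)] by metis
  then show "tri (EAS' f) (tri (EAS' f) a (arr (EAS' f) b c)) (tri (EAS' f) b c) = tri (EAS' f) a b"
    by (simp add: EAS'_def)
qed (simp_all add: EAS'_def)

lemma eas_eas_prod: "eas E \<Longrightarrow> eas F \<Longrightarrow> eas (eas_prod E F)"
  by unfold_locales
    (auto simp: eas_prod_def eas.arr_assoc eas.arr_tri eas.tri_tri split: prod.splits)

corollary eas_EAS_prod_EAS':
  "semigroup f \<Longrightarrow> right_inverse_condition f \<Longrightarrow> eas (eas_prod (EAS f) (EAS' f))"
  by (simp add: eas_EAS eas_EAS' eas_eas_prod)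

lemma eas_prod_EAS_EAS'_simps:
  "arr (eas_prod (EAS f) (EAS' f)) (a, b) (c, d) = (f a c, d)"
  "tri (eas_prod (EAS f) (EAS' f)) (a, b) (c, d) = (a, right_div f b d)"
  by (simp_all add: eas_prod_def EAS_def EAS'_def)


section \<open>Free vector spaces and linearization\<close>

text \<open>
  Vector spaces are HOL-Algebra modules over \<^term>\<open>class_ring\<close>; the ring fields \<open>mult\<close> and
  \<open>one\<close> that the module record inherits play no role and are left undefined.
\<close>

definition pm_scale :: "'k::field \<Rightarrow> ('b \<Rightarrow>\<^sub>0 'k) \<Rightarrow> ('b \<Rightarrow>\<^sub>0 'k)" where
  "pm_scale c = Poly_Mapping.map ((*) c)"

definition free_vs :: "'b set \<Rightarrow> ('k::field, 'b \<Rightarrow>\<^sub>0 'k) module" where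
  "free_vs B =
    \<lparr>carrier = {p. Poly_Mapping.keys p \<subseteq> B}, mult = undefined, one = undefined,
     zero = 0, add = (+), smult = pm_scale\<rparr>"

definition lin_ext :: "('b \<Rightarrow> ('c \<Rightarrow>\<^sub>0 'k)) \<Rightarrow> ('b \<Rightarrow>\<^sub>0 'k::field) \<Rightarrow> ('c \<Rightarrow>\<^sub>0 'k)" where
  "lin_ext g p = (\<Sum>b\<in>Poly_Mapping.keys p. pm_scale (Poly_Mapping.lookup p b) (g b))"

text \<open>
  If \<open>A\<close> is the vector space with basis the type \<open>'x\<close>, then \<open>A \<otimes> A\<close> has the basis of all
  \<open>a \<otimes> b\<close> with \<open>a, b :: 'x\<close>; it is represented by \<open>'x \<times> 'x \<Rightarrow>\<^sub>0 'k\<close>, with \<open>(a, b)\<close>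
  standing for \<open>a \<otimes> b\<close>. The linearization of an EAS is given by the map \<open>\<Phi>\<close> on this space.
\<close>

definition linearization :: "'x eas_ops \<Rightarrow> ('x \<times> 'x \<Rightarrow>\<^sub>0 'k::field) \<Rightarrow> ('x \<times> 'x \<Rightarrow>\<^sub>0 'k)" where
  "linearization E = lin_ext (\<lambda>(p, q). Poly_Mapping.single (arr E p q, tri E p q) 1)"


section \<open>Nonsymmetric operads\<close>

text \<open>
  \<open>pcomp P m n i x y\<close> is the partial composition \<open>x \<circ>\<^sub>i y\<close> for \<open>x \<in> P(m)\<close>, \<open>y \<in> P(n)\<close> and
  \<open>1 \<le> i \<le> m\<close>. The arities are arguments because the carriers of different arities need not be
  disjoint as sets.
\<close>

record ('k, 'v) nsop =
  ar :: "nat \<Rightarrow> ('k, 'v) module"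
  pcomp :: "nat \<Rightarrow> nat \<Rightarrow> nat \<Rightarrow> 'v \<Rightarrow> 'v \<Rightarrow> 'v"
  op_id :: 'v

locale ns_operad =
  fixes K :: "'k ring" and P :: "('k, 'v) nsop"
  assumes vs: "vectorspace K (ar P n)"
    and id_closed: "op_id P \<in> carrier (ar P 1)"
    and linear_left: "\<lbrakk>1 \<le> i; i \<le> m; y \<in> carrier (ar P n)\<rbrakk> \<Longrightarrow>
      linear_map K (ar P m) (ar P (m + n - 1)) (\<lambda>x. pcomp P m n i x y)"
    and linear_right: "\<lbrakk>1 \<le> i; i \<le> m; x \<in> carrier (ar P m)\<rbrakk> \<Longrightarrow>
      linear_map K (ar P n) (ar P (m + n - 1)) (\<lambda>y. pcomp P m n i x y)"
    and sequential: "\<lbrakk>1 \<le> i; i \<le> l; 1 \<le> j; j \<le> m;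
        x \<in> carrier (ar P l); y \<in> carrier (ar P m); z \<in> carrier (ar P n)\<rbrakk> \<Longrightarrow>
      pcomp P (l + m - 1) n (i + j - 1) (pcomp P l m i x y) z =
      pcomp P l (m + n - 1) i x (pcomp P m n j y z)"
    and parallel: "\<lbrakk>1 \<le> i; i < k; k \<le> l;
        x \<in> carrier (ar P l); y \<in> carrier (ar P m); z \<in> carrier (ar P n)\<rbrakk> \<Longrightarrow>
      pcomp P (l + m - 1) n (k + m - 1) (pcomp P l m i x y) z =
      pcomp P (l + n - 1) m i (pcomp P l n k x z) y"
    and id_left: "x \<in> carrier (ar P n) \<Longrightarrow> pcomp P 1 n 1 (op_id P) x = x"
    and id_right: "\<lbrakk>1 \<le> i; i \<le> n; x \<in> carrier (ar P n)\<rbrakk> \<Longrightarrow> pcomp P n 1 i x (op_id P) = x"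

locale ns_operad_hom =
  source: ns_operad K P + target: ns_operad K Q
  for K :: "'k ring" and P :: "('k, 'v) nsop" and Q :: "('k, 'w) nsop" +
  fixes h :: "nat \<Rightarrow> 'v \<Rightarrow> 'w"
  assumes linear: "linear_map K (ar P n) (ar Q n) (h n)"
    and hom_id: "h 1 (op_id P) = op_id Q"
    and hom_pcomp: "\<lbrakk>1 \<le> i; i \<le> m; x \<in> carrier (ar P m); y \<in> carrier (ar P n)\<rbrakk> \<Longrightarrow>
      h (m + n - 1) (pcomp P m n i x y) = pcomp Q m n i (h m x) (h n y)"

definition operad_surjective ::
    "('k, 'v) nsop \<Rightarrow> ('k, 'w) nsop \<Rightarrow> (nat \<Rightarrow> 'v \<Rightarrow> 'w) \<Rightarrow> bool" where
  "operad_surjective P Q h \<longleftrightarrow> (\<forall>n. h n ` carrier (ar P n) = carrier (ar Q n))"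


subsection \<open>Ideals and quotients\<close>

definition operad_ideal :: "'k ring \<Rightarrow> ('k, 'v) nsop \<Rightarrow> (nat \<Rightarrow> 'v set) \<Rightarrow> bool" where
  "operad_ideal K P J \<longleftrightarrow>
    (\<forall>n. VectorSpace.subspace K (J n) (ar P n)) \<and>
    (\<forall>m n i. 1 \<le> i \<longrightarrow> i \<le> m \<longrightarrow>
      (\<forall>x\<in>J m. \<forall>y\<in>carrier (ar P n). pcomp P m n i x y \<in> J (m + n - 1)) \<and>
      (\<forall>x\<in>carrier (ar P m). \<forall>y\<in>J n. pcomp P m n i x y \<in> J (m + n - 1)))"

definition ideal_generated ::
    "'k ring \<Rightarrow> ('k, 'v) nsop \<Rightarrow> (nat \<Rightarrow> 'v set) \<Rightarrow> nat \<Rightarrow> 'v set" where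
  "ideal_generated K P R n = \<Inter> {J n |J. operad_ideal K P J \<and> (\<forall>m. R m \<subseteq> J m)}"

definition quot_vs :: "('k, 'v) module \<Rightarrow> 'v set \<Rightarrow> ('k, 'v set) module" where
  "quot_vs V W =
    \<lparr>carrier = a_rcosets\<^bsub>V\<^esub> W, mult = undefined, one = undefined,
     zero = W, add = set_add V, smult = (\<lambda>c X. \<Union>x\<in>X. W +>\<^bsub>V\<^esub> (c \<odot>\<^bsub>V\<^esub> x))\<rparr>"

definition quot_operad :: "('k, 'v) nsop \<Rightarrow> (nat \<Rightarrow> 'v set) \<Rightarrow> ('k, 'v set) nsop" where
  "quot_operad P J =
    \<lparr>ar = (\<lambda>n. quot_vs (ar P n) (J n)),
     pcomp = (\<lambda>m n i X Y. \<Union>x\<in>X. \<Union>y\<in>Y. J (m + n - 1) +>\<^bsub>ar P (m + n - 1)\<^esub> pcomp P m n i x y),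
     op_id = J 1 +>\<^bsub>ar P 1\<^esub> op_id P\<rparr>"


subsection \<open>The free nonsymmetric operad on binary generators\<close>

text \<open>
  Planar binary trees whose internal nodes are decorated by generators; the arity of a tree is its
  number of leaves \<open>size1\<close>. \<open>graft t i s\<close> replaces the \<open>i\<close>-th leaf of \<open>t\<close>, counted from the left
  starting with 1, by \<open>s\<close>.
\<close>

fun graft :: "'x tree \<Rightarrow> nat \<Rightarrow> 'x tree \<Rightarrow> 'x tree" where
  "graft Leaf i s = s"
| "graft (Node l x r) i s =
    (if i \<le> size1 l then Node (graft l i s) x r else Node l x (graft r (i - size1 l) s))"

definition graft_lin ::
    "nat \<Rightarrow> ('x tree \<Rightarrow>\<^sub>0 'k::field) \<Rightarrow> ('x tree \<Rightarrow>\<^sub>0 'k) \<Rightarrow> ('x tree \<Rightarrow>\<^sub>0 'k)" where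
  "graft_lin i p q = lin_ext (\<lambda>t. lin_ext (\<lambda>s. Poly_Mapping.single (graft t i s) 1) q) p"

definition free_operad :: "('k::field, 'x tree \<Rightarrow>\<^sub>0 'k) nsop" where
  "free_operad =
    \<lparr>ar = (\<lambda>n. free_vs {t. size1 t = n}),
     pcomp = (\<lambda>m n i. graft_lin i),
     op_id = Poly_Mapping.single Leaf 1\<rparr>"

definition free_gen :: "'x \<Rightarrow> ('x tree \<Rightarrow>\<^sub>0 'k::field)" where
  "free_gen x = Poly_Mapping.single (Node Leaf x Leaf) 1"


subsection \<open>Presentation by binary generators and quadratic relations\<close>

text \<open>\<open>R\<close> consists of elements of arity 3 of the free operad, to be set equal to zero.\<close>

definition relations_ideal :: "('x tree \<Rightarrow>\<^sub>0 'k::field) set \<Rightarrow> nat \<Rightarrow> ('x tree \<Rightarrow>\<^sub>0 'k) set" where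
  "relations_ideal R = ideal_generated class_ring free_operad (\<lambda>n. if n = 3 then R else {})"

definition presented_operad ::
    "('x tree \<Rightarrow>\<^sub>0 'k::field) set \<Rightarrow> ('k, ('x tree \<Rightarrow>\<^sub>0 'k) set) nsop" where
  "presented_operad R = quot_operad free_operad (relations_ideal R)"

definition presented_gen ::
    "('x tree \<Rightarrow>\<^sub>0 'k::field) set \<Rightarrow> 'x \<Rightarrow> ('x tree \<Rightarrow>\<^sub>0 'k) set" where
  "presented_gen R x = relations_ideal R 2 +>\<^bsub>ar free_operad 2\<^esub> free_gen x"


section \<open>The two operads\<close>

text \<open>
  For the vector space \<open>A\<close> with basis \<open>'x\<close> and a map \<open>\<Phi>\<close> on \<open>A \<otimes> A\<close>, the operad
  \<open>As\<^sub>\<Phi>\<close> has the relations \<open>*\<^sub>p \<circ>\<^sub>2 *\<^sub>q = \<Sum> c\<^sub>r\<^sub>s *\<^sub>r \<circ>\<^sub>1 *\<^sub>s\<close> where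
  \<open>\<Phi>(p \<otimes> q) = \<Sum> c\<^sub>r\<^sub>s r \<otimes> s\<close>.
\<close>

definition AsPhi_rels ::
    "(('x \<times> 'x \<Rightarrow>\<^sub>0 'k::field) \<Rightarrow> ('x \<times> 'x \<Rightarrow>\<^sub>0 'k)) \<Rightarrow> ('x tree \<Rightarrow>\<^sub>0 'k) set" where
  "AsPhi_rels \<Phi> =
    {graft_lin 2 (free_gen p) (free_gen q)
       - lin_ext (\<lambda>(r, s). graft_lin 1 (free_gen r) (free_gen s))
           (\<Phi> (Poly_Mapping.single (p, q) 1)) |p q. True}"

definition AsPhi ::
    "(('x \<times> 'x \<Rightarrow>\<^sub>0 'k::field) \<Rightarrow> ('x \<times> 'x \<Rightarrow>\<^sub>0 'k)) \<Rightarrow> ('k, ('x tree \<Rightarrow>\<^sub>0 'k) set) nsop" where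
  "AsPhi \<Phi> = presented_operad (AsPhi_rels \<Phi>)"

definition AsPhi_gen ::
    "(('x \<times> 'x \<Rightarrow>\<^sub>0 'k::field) \<Rightarrow> ('x \<times> 'x \<Rightarrow>\<^sub>0 'k)) \<Rightarrow> 'x \<Rightarrow> ('x tree \<Rightarrow>\<^sub>0 'k) set" where
  "AsPhi_gen \<Phi> = presented_gen (AsPhi_rels \<Phi>)"

definition As2_rels :: "('w \<Rightarrow> 'w \<Rightarrow> 'w) \<Rightarrow> (('w \<times> 'w) tree \<Rightarrow>\<^sub>0 'k::field) set" where
  "As2_rels f =
    {graft_lin 1 (free_gen (f a b, c)) (free_gen (a, b))
       - graft_lin 2 (free_gen (a, f b c)) (free_gen (b, c)) |a b c. True}"

definition As2 :: "('w \<Rightarrow> 'w \<Rightarrow> 'w) \<Rightarrow> ('k::field, (('w \<times> 'w) tree \<Rightarrow>\<^sub>0 'k) set) nsop" where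
  "As2 f = presented_operad (As2_rels f)"

definition As2_gen :: "('w \<Rightarrow> 'w \<Rightarrow> 'w) \<Rightarrow> 'w \<times> 'w \<Rightarrow> (('w \<times> 'w) tree \<Rightarrow>\<^sub>0 'k::field) set" where
  "As2_gen f = presented_gen (As2_rels f)"

lemma pm_scale_one [simp]: "pm_scale 1 p = p"
  unfolding pm_scale_def by (rule poly_mapping_eqI) (simp add: Poly_Mapping.map.rep_eq when_def)

lemma lin_ext_single_one [simp]: "lin_ext g (Poly_Mapping.single b 1) = g b"
  by (simp add: lin_ext_def)

lemma AsPhi_rels_linearization:
  "AsPhi_rels (linearization E) =
    {graft_lin 2 (free_gen p) (free_gen q)
       - graft_lin 1 (free_gen (arr E p q)) (free_gen (tri E p q)) |p q. True}"
  by (simp add: AsPhi_rels_def linearization_def)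

end

theory Submission
  imports Defs
begin

text \<open>
  In \<open>As\<^sub>\<Phi>\<close> take the relation for \<open>p = (a, b \<rightarrow> c)\<close> and \<open>q = (b, c)\<close>. Since
  \<open>(b \<rightarrow> c) \<triangleright> c = b\<close>, it reads \<open>*\<^sub>p \<circ>\<^sub>2 *\<^sub>q = *\<^sub>r \<circ>\<^sub>1 *\<^sub>s\<close> with \<open>r = (a \<rightarrow> b, c)\<close> and
  \<open>s = (a, b)\<close>, which is the defining relation of \<open>As\<^sup>2\<^sub>\<Omega>\<close> for \<open>a, b, c\<close>. Both operads are quotients
  of the free operad on the same generators, and the ideal of the first quotient is contained in
  that of the second, so the canonical projection factors. Uniqueness holds because every tree is
  an iterated composition of generators.
\<close>

section \<open>Linear maps and quotient spaces\<close>

lemma linear_mapI: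
  assumes "vectorspace K V" "vectorspace K W"
    and "\<And>x. x \<in> carrier V \<Longrightarrow> f x \<in> carrier W"
    and "\<And>x y. x \<in> carrier V \<Longrightarrow> y \<in> carrier V \<Longrightarrow> f (x \<oplus>\<^bsub>V\<^esub> y) = f x \<oplus>\<^bsub>W\<^esub> f y"
    and "\<And>c x. c \<in> carrier K \<Longrightarrow> x \<in> carrier V \<Longrightarrow> f (c \<odot>\<^bsub>V\<^esub> x) = c \<odot>\<^bsub>W\<^esub> f x"
  shows "linear_map K V W f"
  using assms(3-5)
  by (intro linear_map.intro mod_hom.intro mod_hom_axioms.intro assms(1,2)
      vectorspace.axioms(1)[OF assms(1)] vectorspace.axioms(1)[OF assms(2)])
    (simp add: LinearCombinations.module_hom_def)

text \<open>The vector space axioms are equations, so they pass along a surjection that respects the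
  operations. The structure on \<open>W\<close> is thus a conclusion; for quotients this replaces a
  direct verification of the axioms on cosets.\<close>

lemma linear_map_surj_image:
  fixes V :: "('k, 'v, 'm) module_scheme" and W :: "('k, 'w, 'n) module_scheme"
  assumes "vectorspace K V"
    and surj: "\<pi> ` carrier V = carrier W"
    and zero: "\<pi> \<zero>\<^bsub>V\<^esub> = \<zero>\<^bsub>W\<^esub>"
    and add: "\<And>x y. x \<in> carrier V \<Longrightarrow> y \<in> carrier V \<Longrightarrow> \<pi> (x \<oplus>\<^bsub>V\<^esub> y) = \<pi> x \<oplus>\<^bsub>W\<^esub> \<pi> y"
    and smult: "\<And>c x. c \<in> carrier K \<Longrightarrow> x \<in> carrier V \<Longrightarrow> \<pi> (c \<odot>\<^bsub>V\<^esub> x) = c \<odot>\<^bsub>W\<^esub> \<pi> x"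
  shows "linear_map K V W \<pi>"
proof -
  interpret V: vectorspace K V by fact
  have rep: "\<exists>x\<in>carrier V. X = \<pi> x" if "X \<in> carrier W" for X
    using surj that by blast
  have im: "\<pi> x \<in> carrier W" if "x \<in> carrier V" for x
    using surj that by blast
  \<comment> \<open>Read from right to left, these turn an expression in images under
    \<open>\<pi>\<close> into the image of one expression in \<open>V\<close>, where the axiom is
    known.\<close>
  note add' = add[symmetric] and smult' = smult[symmetric] and zero' = zero[symmetric]
  have "abelian_group W"
  proof (rule abelian_groupI)
    show "X \<oplus>\<^bsub>W\<^esub> Y \<in> carrier W" if "X \<in> carrier W" "Y \<in> carrier W" for X Y
      using rep[OF that(1)] rep[OF that(2)] by (auto simp: add' im)
    show "\<zero>\<^bsub>W\<^esub> \<in> carrier W"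
      by (simp add: zero' im)
    show "X \<oplus>\<^bsub>W\<^esub> Y \<oplus>\<^bsub>W\<^esub> Z = X \<oplus>\<^bsub>W\<^esub> (Y \<oplus>\<^bsub>W\<^esub> Z)"
      if "X \<in> carrier W" "Y \<in> carrier W" "Z \<in> carrier W" for X Y Z
      using rep[OF that(1)] rep[OF that(2)] rep[OF that(3)] by (auto simp: add' V.M.a_assoc)
    show "X \<oplus>\<^bsub>W\<^esub> Y = Y \<oplus>\<^bsub>W\<^esub> X" if "X \<in> carrier W" "Y \<in> carrier W" for X Y
      using rep[OF that(1)] rep[OF that(2)] by (auto simp: add' V.M.a_comm)
    show "\<zero>\<^bsub>W\<^esub> \<oplus>\<^bsub>W\<^esub> X = X" if "X \<in> carrier W" for X
      using rep[OF that] by (auto simp: add' zero')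
    show "\<exists>Y\<in>carrier W. Y \<oplus>\<^bsub>W\<^esub> X = \<zero>\<^bsub>W\<^esub>" if X: "X \<in> carrier W" for X
    proof -
      obtain x where x: "x \<in> carrier V" "X = \<pi> x" using rep[OF X] by blast
      then have "\<pi> (\<ominus>\<^bsub>V\<^esub> x) \<oplus>\<^bsub>W\<^esub> X = \<zero>\<^bsub>W\<^esub>" by (simp add: add' V.M.l_neg zero)
      with x show ?thesis using im by blast
    qed
  qed
  moreover have "module_axioms K W"
  proof
    fix c X assume c: "c \<in> carrier K" and X: "X \<in> carrier W"
    obtain x where x: "x \<in> carrier V" "X = \<pi> x" using rep[OF X] by blast
    show "c \<odot>\<^bsub>W\<^esub> X \<in> carrier W"
      using c x by (simp add: smult' im)
    {
      fix d assume d: "d \<in> carrier K"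
      show "(c \<oplus>\<^bsub>K\<^esub> d) \<odot>\<^bsub>W\<^esub> X = c \<odot>\<^bsub>W\<^esub> X \<oplus>\<^bsub>W\<^esub> d \<odot>\<^bsub>W\<^esub> X"
        using c d x by (simp add: smult' add' V.smult_l_distr)
      show "c \<otimes>\<^bsub>K\<^esub> d \<odot>\<^bsub>W\<^esub> X = c \<odot>\<^bsub>W\<^esub> (d \<odot>\<^bsub>W\<^esub> X)"
        using c d x by (simp add: smult' V.smult_assoc1)
    }
    fix Y assume "Y \<in> carrier W"
    then obtain y where "y \<in> carrier V" "Y = \<pi> y" using rep by blast
    then show "c \<odot>\<^bsub>W\<^esub> (X \<oplus>\<^bsub>W\<^esub> Y) = c \<odot>\<^bsub>W\<^esub> X \<oplus>\<^bsub>W\<^esub> c \<odot>\<^bsub>W\<^esub> Y"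
      using c x by (simp add: smult' add' V.smult_r_distr)
  next
    show "\<one>\<^bsub>K\<^esub> \<odot>\<^bsub>W\<^esub> X = X" if "X \<in> carrier W" for X
      using rep[OF that] by (auto simp: smult')
  qed
  ultimately have W: "vectorspace K W"
    by (intro vectorspace.intro Module.module.intro V.R.is_cring V.field_axioms)
  show ?thesis
    using assms(1) W im add smult by (rule linear_mapI)
qed

lemma linear_map_comp:
  assumes "linear_map K U V f" "linear_map K V W g"
  shows "linear_map K U W (\<lambda>x. g (f x))"
proof -
  interpret f: linear_map K U V f by fact
  interpret g: linear_map K V W g by fact
  show ?thesis
    using f.V.vectorspace_axioms g.W.vectorspace_axioms by (rule linear_mapI) simp_all
qed

text \<open>Every element of \<open>V\<close> is some \<open>p x\<close>, and there \<open>g\<close>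
  is determined by \<open>f\<close>; each identity for \<open>g\<close> is the one for
  \<open>f\<close> at representatives.\<close>

lemma linear_map_factor:
  assumes "linear_map K U V p" "p ` carrier U = carrier V" "linear_map K U W f"
    and "\<And>x. x \<in> carrier U \<Longrightarrow> g (p x) = f x"
  shows "linear_map K V W g"
proof -
  interpret p: linear_map K U V p by fact
  interpret f: linear_map K U W f by fact
  have rep: "\<exists>x\<in>carrier U. X = p x" if "X \<in> carrier V" for X
    using assms(2) that by blast
  show ?thesis
    using p.W.vectorspace_axioms f.W.vectorspace_axioms
  proof (rule linear_mapI)
    show "g X \<in> carrier W" if "X \<in> carrier V" for X
      using rep[OF that] by (auto simp: assms(4))
    show "g (X \<oplus>\<^bsub>V\<^esub> Y) = g X \<oplus>\<^bsub>W\<^esub> g Y" if "X \<in> carrier V" "Y \<in> carrier V" for X Y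
      using rep[OF that(1)] rep[OF that(2)] by (auto simp: assms(4) simp flip: p.f_add)
    show "g (c \<odot>\<^bsub>V\<^esub> X) = c \<odot>\<^bsub>W\<^esub> g X" if "c \<in> carrier K" "X \<in> carrier V" for c X
      using rep[OF that(2)] that(1) by (auto simp: assms(4) simp flip: p.f_smult)
  qed
qed

section \<open>Cosets of a subspace and the quotient space\<close>

text \<open>Closure under negatives comes from multiplication by -1. The point is to make the theory
  of cosets of additive subgroups available.\<close>

lemma subspace_abelian_subgroup:
  assumes "VectorSpace.subspace K W V"
  shows "abelian_subgroup W V"
proof -
  interpret V: vectorspace K V using assms by (rule subspace.vs)
  have sub: "submodule K W V" using assms by (rule subspace.submod)
  note subset = submodule.subset[OF sub]
  have "\<ominus>\<^bsub>V\<^esub> x \<in> W" if "x \<in> W" for x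
    using that subset submodule.smult_closed[OF sub, of "\<ominus>\<^bsub>K\<^esub> \<one>\<^bsub>K\<^esub>" x] V.smult_minus_1[of x]
    by (metis V.R.a_inv_closed V.R.one_closed subsetD)
  then have "subgroup W (add_monoid V)"
    using subset submodule.zero_closed[OF sub] submodule.m_closed[OF sub]
    by (intro group.subgroupI[OF V.M.a_group]) (auto simp flip: a_inv_def)
  then show ?thesis
    by (intro abelian_subgroupI3 additive_subgroupI V.M.abelian_group_axioms)
qed

text \<open>These are the tools for well-definedness: \<open>coset_self\<close> makes a coset
  nonempty, \<open>coset_memE\<close> writes another representative as a shift by \<open>W\<close>,
  and \<open>coset_absorb\<close> discards that shift.\<close>

lemma subspace_coset:
  assumes "VectorSpace.subspace K W V" "x \<in> carrier V"
  shows coset_self: "x \<in> W +>\<^bsub>V\<^esub> x"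
    and coset_memE: "y \<in> W +>\<^bsub>V\<^esub> x \<Longrightarrow> (\<And>w. w \<in> W \<Longrightarrow> y = w \<oplus>\<^bsub>V\<^esub> x \<Longrightarrow> w \<in> carrier V \<Longrightarrow> y \<in> carrier V \<Longrightarrow> thesis) \<Longrightarrow> thesis"
    and coset_absorb: "w \<in> W \<Longrightarrow> W +>\<^bsub>V\<^esub> (w \<oplus>\<^bsub>V\<^esub> x) = W +>\<^bsub>V\<^esub> x"
proof -
  interpret abelian_subgroup W V using assms(1) by (rule subspace_abelian_subgroup)
  show "x \<in> W +>\<^bsub>V\<^esub> x" using assms(2) by (rule a_rcos_self)
  show thesis if "y \<in> W +>\<^bsub>V\<^esub> x"
    and "\<And>w. w \<in> W \<Longrightarrow> y = w \<oplus>\<^bsub>V\<^esub> x \<Longrightarrow> w \<in> carrier V \<Longrightarrow> y \<in> carrier V \<Longrightarrow> thesis"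
    using that assms(2) a_subset by (auto simp: a_r_coset_def')
  show "W +>\<^bsub>V\<^esub> (w \<oplus>\<^bsub>V\<^esub> x) = W +>\<^bsub>V\<^esub> x" if "w \<in> W"
    using that assms(2) a_subset a_subgroup
    by (intro a_repr_independence[symmetric] a_rcosI) auto
qed

lemma quot_vs_surj: "(\<lambda>x. W +>\<^bsub>V\<^esub> x) ` carrier V = carrier (quot_vs V W)"
  by (auto simp: quot_vs_def A_RCOSETS_def')

text \<open>Addition is the usual sum of cosets; the scalar multiple is defined as a union over
  representatives, which has to collapse to one coset. The conclusion includes that the quotient is
  a vector space.\<close>

lemma quot_vs_linear_map:
  assumes "VectorSpace.subspace K W V"
  shows "linear_map K V (quot_vs V W) (\<lambda>x. W +>\<^bsub>V\<^esub> x)"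
proof (rule linear_map_surj_image)
  interpret A: abelian_subgroup W V using assms by (rule subspace_abelian_subgroup)
  show V: "vectorspace K V" using assms by (rule subspace.vs)
  show "(\<lambda>x. W +>\<^bsub>V\<^esub> x) ` carrier V = carrier (quot_vs V W)"
    by (rule quot_vs_surj)
  show "W +>\<^bsub>V\<^esub> \<zero>\<^bsub>V\<^esub> = \<zero>\<^bsub>quot_vs V W\<^esub>"
    unfolding quot_vs_def by (simp only: module.simps ring_record_simps A.a_coset_add_zero[OF A.a_subset])
  show "W +>\<^bsub>V\<^esub> (x \<oplus>\<^bsub>V\<^esub> y) = (W +>\<^bsub>V\<^esub> x) \<oplus>\<^bsub>quot_vs V W\<^esub> (W +>\<^bsub>V\<^esub> y)"
    if "x \<in> carrier V" "y \<in> carrier V" for x y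
    using that by (simp add: quot_vs_def A.a_rcos_sum)
  fix c x assume c: "c \<in> carrier K" and x: "x \<in> carrier V"
  \<comment> \<open>Changing the representative by \<open>w\<close> changes the multiple by
    \<open>c\<close> times \<open>w\<close>, which stays in \<open>W\<close>.\<close>
  have "W +>\<^bsub>V\<^esub> (c \<odot>\<^bsub>V\<^esub> y) = W +>\<^bsub>V\<^esub> (c \<odot>\<^bsub>V\<^esub> x)" if y: "y \<in> W +>\<^bsub>V\<^esub> x" for y
  proof -
    obtain w where w: "w \<in> W" "y = w \<oplus>\<^bsub>V\<^esub> x" "w \<in> carrier V"
      using assms x y by (rule coset_memE)
    have "c \<odot>\<^bsub>V\<^esub> y = (c \<odot>\<^bsub>V\<^esub> w) \<oplus>\<^bsub>V\<^esub> (c \<odot>\<^bsub>V\<^esub> x)"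
      using w c x module.smult_r_distr[OF vectorspace.axioms(1)[OF V]] by simp
    moreover have "c \<odot>\<^bsub>V\<^esub> w \<in> W"
      using submodule.smult_closed[OF subspace.submod[OF assms]] c w by blast
    moreover have "c \<odot>\<^bsub>V\<^esub> x \<in> carrier V"
      using module.smult_closed[OF vectorspace.axioms(1)[OF V]] c x by blast
    ultimately show ?thesis by (simp add: coset_absorb[OF assms])
  qed
  \<comment> \<open>A union of a constant family over a nonempty index set.\<close>
  then have "(\<Union>y\<in>W +>\<^bsub>V\<^esub> x. W +>\<^bsub>V\<^esub> (c \<odot>\<^bsub>V\<^esub> y)) = W +>\<^bsub>V\<^esub> (c \<odot>\<^bsub>V\<^esub> x)"
    using coset_self[OF assms x] by - (rule SUP_eq_const, blast+)
  then show "W +>\<^bsub>V\<^esub> (c \<odot>\<^bsub>V\<^esub> x) = c \<odot>\<^bsub>quot_vs V W\<^esub> (W +>\<^bsub>V\<^esub> x)"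
    by (simp add: quot_vs_def)
qed


section \<open>Quotients of nonsymmetric operads\<close>

lemma ns_operad_pcomp_closed:
  assumes "ns_operad K P" "1 \<le> i" "i \<le> m" "x \<in> carrier (ar P m)" "y \<in> carrier (ar P n)"
  shows "pcomp P m n i x y \<in> carrier (ar P (m + n - 1))"
proof -
  interpret L: linear_map K "ar P m" "ar P (m + n - 1)" "\<lambda>x. pcomp P m n i x y"
    using assms by (intro ns_operad.linear_left)
  show ?thesis using assms(4) by (rule L.f_im)
qed

text \<open>The operadic counterpart of \<open>linear_map_surj_image\<close>: \<open>Q\<close> only
  carries operations, and all operad axioms are inherited from \<open>P\<close> by choosing
  preimages.\<close>

lemma ns_operad_hom_surj_image:
  assumes P: "ns_operad K P"
    and lin: "\<And>n. linear_map K (ar P n) (ar Q n) (\<pi> n)"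
    and surj: "\<And>n. \<pi> n ` carrier (ar P n) = carrier (ar Q n)"
    and id: "\<pi> 1 (op_id P) = op_id Q"
    and pcomp: "\<And>m n i x y. \<lbrakk>1 \<le> i; i \<le> m; x \<in> carrier (ar P m); y \<in> carrier (ar P n)\<rbrakk> \<Longrightarrow>
      \<pi> (m + n - 1) (pcomp P m n i x y) = pcomp Q m n i (\<pi> m x) (\<pi> n y)"
  shows "ns_operad_hom K P Q \<pi>"
proof -
  interpret P: ns_operad K P by fact
  have rep: "\<exists>x\<in>carrier (ar P n). X = \<pi> n x" if "X \<in> carrier (ar Q n)" for X n
    using surj that by blast
  note closed = ns_operad_pcomp_closed[OF P]
  have "ns_operad K Q"
  proof (rule ns_operad.intro)
    show "vectorspace K (ar Q n)" for n
      using lin[of n] by (rule linear_map.axioms(2))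
    show "op_id Q \<in> carrier (ar Q 1)"
      unfolding id[symmetric] surj[symmetric] by (rule imageI[OF P.id_closed])
    show "linear_map K (ar Q m) (ar Q (m + n - 1)) (\<lambda>X. pcomp Q m n i X Y)"
      if i: "1 \<le> i" "i \<le> m" and Y: "Y \<in> carrier (ar Q n)" for i m n Y
    proof -
      obtain y where y: "y \<in> carrier (ar P n)" "Y = \<pi> n y" using rep[OF Y] by blast
      \<comment> \<open>On representatives the map is composition with \<open>y\<close> in
        \<open>P\<close> followed by \<open>\<pi>\<close>, a linear map that factors through
        \<open>\<pi>\<close>.\<close>
      show ?thesis
        using lin[of m] surj[of m] linear_map_comp[OF P.linear_left[OF i y(1)] lin]
        by (rule linear_map_factor) (simp only: pcomp i y)
    qed
    show "linear_map K (ar Q n) (ar Q (m + n - 1)) (\<lambda>Y. pcomp Q m n i X Y)"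
      if i: "1 \<le> i" "i \<le> m" and X: "X \<in> carrier (ar Q m)" for i m X n
    proof -
      obtain x where x: "x \<in> carrier (ar P m)" "X = \<pi> m x" using rep[OF X] by blast
      show ?thesis
        using lin[of n] surj[of n] linear_map_comp[OF P.linear_right[OF i x(1)] lin]
        by (rule linear_map_factor) (simp only: pcomp i x)
    qed
    show "pcomp Q (l + m - 1) n (i + j - 1) (pcomp Q l m i X Y) Z =
        pcomp Q l (m + n - 1) i X (pcomp Q m n j Y Z)"
      if ij: "1 \<le> i" "i \<le> l" "1 \<le> j" "j \<le> m" and X: "X \<in> carrier (ar Q l)"
        and Y: "Y \<in> carrier (ar Q m)" and Z: "Z \<in> carrier (ar Q n)" for i l j m X Y Z n
    proof -
      obtain x y z where x: "x \<in> carrier (ar P l)" "X = \<pi> l x"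
        and y: "y \<in> carrier (ar P m)" "Y = \<pi> m y" and z: "z \<in> carrier (ar P n)" "Z = \<pi> n z"
        using rep[OF X] rep[OF Y] rep[OF Z] by blast
      have "pcomp Q (l + m - 1) n (i + j - 1) (pcomp Q l m i X Y) Z
          = pcomp Q (l + m - 1) n (i + j - 1) (\<pi> (l + m - 1) (pcomp P l m i x y)) (\<pi> n z)"
        using ij x y z by (simp only: pcomp)
      also have "\<dots> = \<pi> (l + m - 1 + n - 1) (pcomp P (l + m - 1) n (i + j - 1) (pcomp P l m i x y) z)"
        using ij by (intro pcomp[symmetric] closed x y z) auto
      \<comment> \<open>Subtraction on naturals truncates: the bounds on \<open>i\<close> and
        \<open>j\<close> make \<open>l\<close> and \<open>m\<close> positive, so the arities agree
        even for \<open>n = 0\<close>.\<close>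
      also have "l + m - 1 + n - 1 = l + (m + n - 1) - 1"
        using ij by simp
      also have "pcomp P (l + m - 1) n (i + j - 1) (pcomp P l m i x y) z
          = pcomp P l (m + n - 1) i x (pcomp P m n j y z)"
        using ij x y z by (intro P.sequential)
      also have "\<pi> (l + (m + n - 1) - 1) \<dots> = pcomp Q l (m + n - 1) i X (\<pi> (m + n - 1) (pcomp P m n j y z))"
        unfolding x(2) using ij by (intro pcomp closed x y z) auto
      also have "\<pi> (m + n - 1) (pcomp P m n j y z) = pcomp Q m n j Y Z"
        using ij y z by (simp only: pcomp)
      finally show ?thesis .
    qed
    show "pcomp Q (l + m - 1) n (k + m - 1) (pcomp Q l m i X Y) Z =
        pcomp Q (l + n - 1) m i (pcomp Q l n k X Z) Y"
      if ik: "1 \<le> i" "i < k" "k \<le> l" and X: "X \<in> carrier (ar Q l)"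
        and Y: "Y \<in> carrier (ar Q m)" and Z: "Z \<in> carrier (ar Q n)" for i k l X Y m Z n
    proof -
      obtain x y z where x: "x \<in> carrier (ar P l)" "X = \<pi> l x"
        and y: "y \<in> carrier (ar P m)" "Y = \<pi> m y" and z: "z \<in> carrier (ar P n)" "Z = \<pi> n z"
        using rep[OF X] rep[OF Y] rep[OF Z] by blast
      have "pcomp Q l m i X Y = \<pi> (l + m - 1) (pcomp P l m i x y)"
        unfolding x y using ik by (intro pcomp[symmetric] x y) auto
      then have "pcomp Q (l + m - 1) n (k + m - 1) (pcomp Q l m i X Y) Z
          = pcomp Q (l + m - 1) n (k + m - 1) (\<pi> (l + m - 1) (pcomp P l m i x y)) (\<pi> n z)"
        by (simp only: z)
      also have "\<dots> = \<pi> (l + m - 1 + n - 1) (pcomp P (l + m - 1) n (k + m - 1) (pcomp P l m i x y) z)"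
        using ik by (intro pcomp[symmetric] closed x y z) auto
      \<comment> \<open>Two distinct inputs \<open>i < k\<close> force \<open>l\<close> to be at
        least 2, so nothing is truncated.\<close>
      also have "l + m - 1 + n - 1 = l + n - 1 + m - 1"
        using ik by simp
      also have "pcomp P (l + m - 1) n (k + m - 1) (pcomp P l m i x y) z
          = pcomp P (l + n - 1) m i (pcomp P l n k x z) y"
        using ik x y z by (intro P.parallel)
      also have "\<pi> (l + n - 1 + m - 1) \<dots> = pcomp Q (l + n - 1) m i (\<pi> (l + n - 1) (pcomp P l n k x z)) Y"
        unfolding y(2) using ik by (intro pcomp closed x y z) auto
      also have "\<pi> (l + n - 1) (pcomp P l n k x z) = pcomp Q l n k X Z"
        unfolding x(2) z(2) using ik by (intro pcomp x z) auto
      finally show ?thesis .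
    qed
    show "pcomp Q 1 n 1 (op_id Q) X = X" if X: "X \<in> carrier (ar Q n)" for X n
    proof -
      obtain x where x: "x \<in> carrier (ar P n)" "X = \<pi> n x" using rep[OF X] by blast
      have "pcomp Q 1 n 1 (\<pi> 1 (op_id P)) (\<pi> n x) = \<pi> (1 + n - 1) (pcomp P 1 n 1 (op_id P) x)"
        by (intro pcomp[symmetric] P.id_closed x) auto
      then show ?thesis unfolding id x(2) P.id_left[OF x(1)] by simp
    qed
    show "pcomp Q n 1 i X (op_id Q) = X"
      if i: "1 \<le> i" "i \<le> n" and X: "X \<in> carrier (ar Q n)" for i n X
    proof -
      obtain x where x: "x \<in> carrier (ar P n)" "X = \<pi> n x" using rep[OF X] by blast
      have "pcomp Q n 1 i (\<pi> n x) (\<pi> 1 (op_id P)) = \<pi> (n + 1 - 1) (pcomp P n 1 i x (op_id P))"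
        by (intro pcomp[symmetric] P.id_closed x i)
      then show ?thesis unfolding id x(2) P.id_right[OF i x(1)] by simp
    qed
  qed
  with P show ?thesis
    by (intro ns_operad_hom.intro ns_operad_hom_axioms.intro lin id pcomp)
qed

section \<open>Composition and factorization of operad morphisms\<close>

lemma ns_operad_hom_closed:
  assumes "ns_operad_hom K P Q h" "x \<in> carrier (ar P n)"
  shows "h n x \<in> carrier (ar Q n)"
proof -
  interpret L: linear_map K "ar P n" "ar Q n" "h n"
    using assms(1) by (rule ns_operad_hom.linear)
  show ?thesis using assms(2) by (rule L.f_im)
qed

lemma ns_operad_hom_comp:
  assumes "ns_operad_hom K P Q g" "ns_operad_hom K Q R h"
  shows "ns_operad_hom K P R (\<lambda>n x. h n (g n x))"
proof -
  interpret g: ns_operad_hom K P Q g by fact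
  interpret h: ns_operad_hom K Q R h by fact
  show ?thesis
  proof (intro ns_operad_hom.intro ns_operad_hom_axioms.intro)
    show "linear_map K (ar P n) (ar R n) (\<lambda>x. h n (g n x))" for n
      using g.linear h.linear by (rule linear_map_comp)
    show "h 1 (g 1 (op_id P)) = op_id R"
      by (simp only: g.hom_id h.hom_id)
  qed (simp_all only: g.hom_pcomp h.hom_pcomp ns_operad_hom_closed[OF assms(1)]
      g.source.ns_operad_axioms h.target.ns_operad_axioms)
qed

text \<open>As in \<open>linear_map_factor\<close>, the laws for \<open>h\<close> are those for
  \<open>g\<close> at preimages under \<open>p\<close>.\<close>

lemma ns_operad_hom_factor:
  assumes "ns_operad_hom K P Q p" "operad_surjective P Q p" "ns_operad_hom K P R g"
    and fac: "\<And>n x. x \<in> carrier (ar P n) \<Longrightarrow> h n (p n x) = g n x"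
  shows "ns_operad_hom K Q R h"
proof -
  interpret p: ns_operad_hom K P Q p by fact
  interpret g: ns_operad_hom K P R g by fact
  have surj: "p n ` carrier (ar P n) = carrier (ar Q n)" for n
    using assms(2) by (simp add: operad_surjective_def)
  show ?thesis
  proof (intro ns_operad_hom.intro ns_operad_hom_axioms.intro)
    show "linear_map K (ar Q n) (ar R n) (h n)" for n
      using p.linear surj g.linear fac by (rule linear_map_factor)
    show "h 1 (op_id Q) = op_id R"
      by (simp only: p.hom_id[symmetric] fac[OF p.source.id_closed] g.hom_id)
    show "h (m + n - 1) (pcomp Q m n i X Y) = pcomp R m n i (h m X) (h n Y)"
      if i: "1 \<le> i" "i \<le> m" and X: "X \<in> carrier (ar Q m)" and Y: "Y \<in> carrier (ar Q n)"
      for i m X Y n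
    proof -
      obtain x y where x: "x \<in> carrier (ar P m)" "X = p m x"
        and y: "y \<in> carrier (ar P n)" "Y = p n y"
        using X Y surj[of m, symmetric] surj[of n, symmetric] by blast
      show ?thesis
        using i x(1) y(1) ns_operad_pcomp_closed[OF p.source.ns_operad_axioms i x(1) y(1)]
        unfolding x(2) y(2) by (simp only: p.hom_pcomp[symmetric] g.hom_pcomp fac)
    qed
  qed (simp_all only: p.target.ns_operad_axioms g.target.ns_operad_axioms)
qed

section \<open>Operadic ideals and quotient operads\<close>

lemma operad_idealD:
  assumes "operad_ideal K P J"
  shows "VectorSpace.subspace K (J n) (ar P n)"
    and "\<lbrakk>1 \<le> i; i \<le> m; x \<in> J m; y \<in> carrier (ar P n)\<rbrakk> \<Longrightarrow> pcomp P m n i x y \<in> J (m + n - 1)"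
    and "\<lbrakk>1 \<le> i; i \<le> m; x \<in> carrier (ar P m); y \<in> J n\<rbrakk> \<Longrightarrow> pcomp P m n i x y \<in> J (m + n - 1)"
  using assms unfolding operad_ideal_def by blast+

lemma operad_surjective_quot: "operad_surjective P (quot_operad P J) (\<lambda>n x. J n +>\<^bsub>ar P n\<^esub> x)"
  by (simp add: operad_surjective_def quot_operad_def quot_vs_surj)

text \<open>Composition in the quotient is a union over pairs of representatives; closure of
  \<open>J\<close> under composition on either side makes all its members equal. That the quotient
  is an operad is part of the conclusion.\<close>

lemma quot_operad_proj:
  assumes P: "ns_operad K P" and J: "operad_ideal K P J"
  shows "ns_operad_hom K P (quot_operad P J) (\<lambda>n x. J n +>\<^bsub>ar P n\<^esub> x)"
proof (rule ns_operad_hom_surj_image)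
  interpret P: ns_operad K P by fact
  note sub = operad_idealD(1)[OF J]
  show "ns_operad K P" by fact
  show "linear_map K (ar P n) (ar (quot_operad P J) n) ((+>\<^bsub>ar P n\<^esub>) (J n))" for n
    using quot_vs_linear_map[OF sub] by (simp add: quot_operad_def)
  show "(+>\<^bsub>ar P n\<^esub>) (J n) ` carrier (ar P n) = carrier (ar (quot_operad P J) n)" for n
    by (simp add: quot_operad_def quot_vs_surj)
  show "J 1 +>\<^bsub>ar P 1\<^esub> op_id P = op_id (quot_operad P J)"
    by (simp add: quot_operad_def)
  fix m n i x y
  assume i: "1 \<le> i" "i \<le> m" and x: "x \<in> carrier (ar P m)" and y: "y \<in> carrier (ar P n)"
  let ?c = "\<lambda>x y. J (m + n - 1) +>\<^bsub>ar P (m + n - 1)\<^esub> pcomp P m n i x y"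
  have "?c x' y' = ?c x y" if x': "x' \<in> J m +>\<^bsub>ar P m\<^esub> x" and y': "y' \<in> J n +>\<^bsub>ar P n\<^esub> y" for x' y'
  proof -
    obtain v where v: "v \<in> J m" "x' = v \<oplus>\<^bsub>ar P m\<^esub> x" "v \<in> carrier (ar P m)"
      using sub x x' by (rule coset_memE)
    obtain w where w: "w \<in> J n" "y' = w \<oplus>\<^bsub>ar P n\<^esub> y" "w \<in> carrier (ar P n)" "y' \<in> carrier (ar P n)"
      using sub y y' by (rule coset_memE)
    interpret L: linear_map K "ar P m" "ar P (m + n - 1)" "\<lambda>x. pcomp P m n i x y'"
      using i w(4) by (rule P.linear_left)
    interpret R: linear_map K "ar P n" "ar P (m + n - 1)" "\<lambda>y. pcomp P m n i x y"
      using i x by (rule P.linear_right)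
    \<comment> \<open>The representatives are exchanged one at a time: linearity in the first
      argument splits off \<open>v\<close> composed with \<open>y'\<close>, an element of the ideal;
      then the same is done in the second argument with \<open>x\<close> fixed.\<close>
    have "?c x' y' = ?c x y'"
      unfolding v(2) L.f_add[OF v(3) x]
      using sub L.f_im[OF x] operad_idealD(2)[OF J i v(1) w(4)] by (rule coset_absorb)
    also have "?c x y' = ?c x y"
      unfolding w(2) R.f_add[OF w(3) y]
      using sub R.f_im[OF y] operad_idealD(3)[OF J i x w(1)] by (rule coset_absorb)
    finally show ?thesis .
  qed
  then have "(\<Union>x'\<in>J m +>\<^bsub>ar P m\<^esub> x. \<Union>y'\<in>J n +>\<^bsub>ar P n\<^esub> y. ?c x' y') = ?c x y"
    using coset_self[OF sub x] coset_self[OF sub y] by blast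
  then show "?c x y = pcomp (quot_operad P J) m n i (J m +>\<^bsub>ar P m\<^esub> x) (J n +>\<^bsub>ar P n\<^esub> y)"
    by (simp add: quot_operad_def)
qed

text \<open>The map \<open>h\<close> is the canonical projection between the quotients. As
  \<open>I\<close> lies in \<open>J\<close>, all elements of one \<open>I\<close>-coset have the
  same \<open>J\<close>-coset, so the union defining \<open>h\<close> is a single coset; the
  morphism laws follow by factoring the projection to the second quotient through the first.\<close>

lemma quot_operad_mono_hom:
  assumes P: "ns_operad K P" and I: "operad_ideal K P I" and J: "operad_ideal K P J"
    and sub: "\<And>n. I n \<subseteq> J n"
  defines "h \<equiv> \<lambda>n X. \<Union>x\<in>X. J n +>\<^bsub>ar P n\<^esub> x"
  shows "ns_operad_hom K (quot_operad P I) (quot_operad P J) h"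
    and "x \<in> carrier (ar P n) \<Longrightarrow> h n (I n +>\<^bsub>ar P n\<^esub> x) = J n +>\<^bsub>ar P n\<^esub> x"
    and "operad_surjective (quot_operad P I) (quot_operad P J) h"
proof -
  have h: "h n (I n +>\<^bsub>ar P n\<^esub> x) = J n +>\<^bsub>ar P n\<^esub> x" if x: "x \<in> carrier (ar P n)" for n x
  proof -
    have "J n +>\<^bsub>ar P n\<^esub> y = J n +>\<^bsub>ar P n\<^esub> x" if y: "y \<in> I n +>\<^bsub>ar P n\<^esub> x" for y
    proof -
      obtain w where "w \<in> I n" "y = w \<oplus>\<^bsub>ar P n\<^esub> x"
        using operad_idealD(1)[OF I] x y by (rule coset_memE)
      then show ?thesis
        using sub coset_absorb[OF operad_idealD(1)[OF J] x] by blast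
    qed
    then show ?thesis
      unfolding h_def using coset_self[OF operad_idealD(1)[OF I] x] by blast
  qed
  then show "x \<in> carrier (ar P n) \<Longrightarrow> h n (I n +>\<^bsub>ar P n\<^esub> x) = J n +>\<^bsub>ar P n\<^esub> x" .
  show "ns_operad_hom K (quot_operad P I) (quot_operad P J) h"
    using quot_operad_proj[OF P I] operad_surjective_quot quot_operad_proj[OF P J] h
    by (rule ns_operad_hom_factor)
  have "h n ` carrier (ar (quot_operad P I) n) = (\<lambda>x. J n +>\<^bsub>ar P n\<^esub> x) ` carrier (ar P n)" for n
    by (simp add: quot_operad_def quot_vs_surj[symmetric] image_image h)
  then show "operad_surjective (quot_operad P I) (quot_operad P J) h"
    by (simp add: operad_surjective_def quot_vs_surj) (simp add: quot_operad_def)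
qed

section \<open>The ideal generated by a family of elements\<close>

lemma ideal_generated_least:
  assumes "operad_ideal K P J" "\<And>m. R m \<subseteq> J m"
  shows "ideal_generated K P R n \<subseteq> J n"
  using assms by (auto simp: ideal_generated_def)

text \<open>All closure conditions pass to intersections. Only containment in the carriers requires
  an ideal that actually occurs in the intersection.\<close>

lemma ideal_generated_ideal:
  assumes "ns_operad K P" "\<And>n. R n \<subseteq> carrier (ar P n)"
  shows "operad_ideal K P (ideal_generated K P R)"
    and "R n \<subseteq> ideal_generated K P R n"
proof -
  interpret P: ns_operad K P by fact
  \<comment> \<open>The whole operad is an ideal containing \<open>R\<close>, so it bounds the
    intersection.\<close>
  have carr: "operad_ideal K P (\<lambda>n. carrier (ar P n))"
    unfolding operad_ideal_def
  proof (intro conjI allI impI ballI)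
    show "VectorSpace.subspace K (carrier (ar P n)) (ar P n)" for n
    proof -
      interpret V: vectorspace K "ar P n" by (rule P.vs)
      show ?thesis
        by (intro subspace.intro submodule.intro P.vs vectorspace.axioms(1)) auto
    qed
  qed (rule ns_operad_pcomp_closed[OF assms(1)]; assumption)+
  show "R n \<subseteq> ideal_generated K P R n"
    by (auto simp: ideal_generated_def)
  have mem: "x \<in> ideal_generated K P R n \<longleftrightarrow>
      (\<forall>J. operad_ideal K P J \<longrightarrow> (\<forall>m. R m \<subseteq> J m) \<longrightarrow> x \<in> J n)" for x n
    by (auto simp: ideal_generated_def)
  show "operad_ideal K P (ideal_generated K P R)"
    unfolding operad_ideal_def
  proof (intro conjI allI impI ballI)
    show "VectorSpace.subspace K (ideal_generated K P R n) (ar P n)" for n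
    proof (intro subspace.intro submodule.intro P.vs vectorspace.axioms(1))
      have sm: "submodule K (J n) (ar P n)" if "operad_ideal K P J" for J
        using that by (intro subspace.submod operad_idealD(1))
      show "ideal_generated K P R n \<subseteq> carrier (ar P n)"
        using carr assms(2) by (rule ideal_generated_least)
      show "v \<oplus>\<^bsub>ar P n\<^esub> w \<in> ideal_generated K P R n"
        if "v \<in> ideal_generated K P R n" "w \<in> ideal_generated K P R n" for v w
        using that unfolding mem by (blast intro: submodule.m_closed[OF sm])
      show "\<zero>\<^bsub>ar P n\<^esub> \<in> ideal_generated K P R n"
        unfolding mem by (blast intro: submodule.zero_closed[OF sm])
      show "c \<odot>\<^bsub>ar P n\<^esub> v \<in> ideal_generated K P R n"
        if "c \<in> carrier K" "v \<in> ideal_generated K P R n" for c v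
        using that unfolding mem by (blast intro: submodule.smult_closed[OF sm])
    qed
    fix m n i :: nat and x y assume i: "1 \<le> i" "i \<le> m"
    show "pcomp P m n i x y \<in> ideal_generated K P R (m + n - 1)"
      if "x \<in> ideal_generated K P R m" "y \<in> carrier (ar P n)"
      using that unfolding mem by (blast intro: operad_idealD(2)[OF _ i])
    show "pcomp P m n i x y \<in> ideal_generated K P R (m + n - 1)"
      if "x \<in> carrier (ar P m)" "y \<in> ideal_generated K P R n"
      using that unfolding mem by (blast intro: operad_idealD(3)[OF _ i])
  qed
qed


section \<open>The free operad\<close>

lemma lookup_pm_scale [simp]: "Poly_Mapping.lookup (pm_scale c p) k = c * Poly_Mapping.lookup p k"
  by (simp add: pm_scale_def Poly_Mapping.map.rep_eq when_def)

lemma pm_scale_zero [simp]: "pm_scale c 0 = 0" "pm_scale 0 p = 0"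
  by (rule poly_mapping_eqI, simp)+

lemma pm_scale_add: "pm_scale c (p + q) = pm_scale c p + pm_scale c q"
  by (rule poly_mapping_eqI) (simp add: lookup_add distrib_left)

lemma pm_scale_add_left: "pm_scale (c + d) p = pm_scale c p + pm_scale d p"
  by (rule poly_mapping_eqI) (simp add: lookup_add distrib_right)

lemma pm_scale_pm_scale: "pm_scale c (pm_scale d p) = pm_scale (c * d) p"
  by (rule poly_mapping_eqI) (simp add: mult.assoc)

lemma pm_scale_minus_one: "pm_scale (- 1) p = - p"
  by (rule poly_mapping_eqI) simp

lemma pm_scale_sum: "pm_scale c (sum f A) = (\<Sum>a\<in>A. pm_scale c (f a))"
  by (induction A rule: infinite_finite_induct) (simp_all add: pm_scale_add)

lemma pm_scale_single: "pm_scale c (Poly_Mapping.single b d) = Poly_Mapping.single b (c * d)"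
  by (rule poly_mapping_eqI) (simp add: lookup_single when_def)

lemma keys_pm_scale: "Poly_Mapping.keys (pm_scale c p) \<subseteq> Poly_Mapping.keys p"
  by (auto simp: in_keys_iff)

lemma free_vs_simps [simp]:
  "p \<in> carrier (free_vs B) \<longleftrightarrow> Poly_Mapping.keys p \<subseteq> B"
  "\<zero>\<^bsub>free_vs B\<^esub> = 0" "p \<oplus>\<^bsub>free_vs B\<^esub> q = p + q" "c \<odot>\<^bsub>free_vs B\<^esub> p = pm_scale c p"
  by (simp_all add: free_vs_def)

lemma vectorspace_free_vs: "vectorspace class_ring (free_vs B :: ('k::field, 'b \<Rightarrow>\<^sub>0 'k) module)"
proof (rule vectorspace.intro[OF _ class_field], rule moduleI, rule class_cring.is_cring, rule abelian_groupI)
  let ?V = "free_vs B :: ('k, 'b \<Rightarrow>\<^sub>0 'k) module"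
  show "p \<oplus>\<^bsub>?V\<^esub> q \<in> carrier ?V" if "p \<in> carrier ?V" "q \<in> carrier ?V" for p q
    using that keys_add[of p q] by auto
  show "c \<odot>\<^bsub>?V\<^esub> p \<in> carrier ?V" if "p \<in> carrier ?V" for c p
    using that keys_pm_scale[of c p] by auto
  show "\<exists>q\<in>carrier ?V. q \<oplus>\<^bsub>?V\<^esub> p = \<zero>\<^bsub>?V\<^esub>" if "p \<in> carrier ?V" for p
    using that by (intro bexI[of _ "- p"]) auto
qed (simp_all add: pm_scale_add pm_scale_add_left pm_scale_pm_scale add.assoc add.commute)

section \<open>Linear extension and induction over a free vector space\<close>

text \<open>Terms outside the support vanish. Additivity relies on this, because cancellation can
  make the support of \<open>p + q\<close> smaller than the union of the two supports.\<close>

lemma lin_ext_superset: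
  assumes "finite S" "Poly_Mapping.keys p \<subseteq> S"
  shows "lin_ext g p = (\<Sum>b\<in>S. pm_scale (Poly_Mapping.lookup p b) (g b))"
  unfolding lin_ext_def using assms by (intro sum.mono_neutral_left) (auto simp: in_keys_iff)

lemma lin_ext_add: "lin_ext g (p + q) = lin_ext g p + lin_ext g q"
proof -
  let ?S = "Poly_Mapping.keys p \<union> Poly_Mapping.keys q"
  have "lin_ext g r = (\<Sum>b\<in>?S. pm_scale (Poly_Mapping.lookup r b) (g b))"
    if "r \<in> {p, q, p + q}" for r
    using that keys_add[of p q] by (intro lin_ext_superset) auto
  then show ?thesis by (simp add: lookup_add pm_scale_add_left sum.distrib)
qed

lemma lin_ext_scale: "lin_ext g (pm_scale c p) = pm_scale c (lin_ext g p)"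
  by (subst lin_ext_superset[OF finite_keys keys_pm_scale])
    (simp add: lin_ext_def pm_scale_sum pm_scale_pm_scale)

lemma lin_ext_zero [simp]: "lin_ext g 0 = 0"
  by (simp add: lin_ext_def)

lemma lin_ext_fun_add: "lin_ext (\<lambda>b. g b + h b) p = lin_ext g p + lin_ext h p"
  by (simp add: lin_ext_def pm_scale_add sum.distrib)

lemma lin_ext_fun_scale: "lin_ext (\<lambda>b. pm_scale c (g b)) p = pm_scale c (lin_ext g p)"
  by (simp add: lin_ext_def pm_scale_sum pm_scale_pm_scale mult.commute)

lemma lin_ext_fun_zero [simp]: "lin_ext (\<lambda>b. 0) p = 0"
  by (simp add: lin_ext_def)

text \<open>A finitely supported function is a finite combination of basis vectors. The rule reduces
  multilinear identities to basis elements, one argument at a time.\<close>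

lemma free_vs_induct [consumes 1, case_names zero add scale basis]:
  fixes p :: "'b \<Rightarrow>\<^sub>0 'k::field"
  assumes p: "Poly_Mapping.keys p \<subseteq> B"
    and zero: "P 0"
    and add: "\<And>p q. Poly_Mapping.keys p \<subseteq> B \<Longrightarrow> Poly_Mapping.keys q \<subseteq> B \<Longrightarrow> P p \<Longrightarrow> P q \<Longrightarrow> P (p + q)"
    and scale: "\<And>c p. Poly_Mapping.keys p \<subseteq> B \<Longrightarrow> P p \<Longrightarrow> P (pm_scale c p)"
    and basis: "\<And>b. b \<in> B \<Longrightarrow> P (Poly_Mapping.single b 1)"
  shows "P p"
proof -
  let ?t = "\<lambda>b. pm_scale (Poly_Mapping.lookup p b) (Poly_Mapping.single b 1)"
  have single: "Poly_Mapping.keys (?t b) \<subseteq> B \<and> P (?t b)" if "b \<in> B" for b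
    using scale[OF _ basis, of b] that keys_pm_scale[of "Poly_Mapping.lookup p b" "Poly_Mapping.single b 1"]
    by auto
  \<comment> \<open>The support bound is carried along since the hypothesis \<open>add\<close>
    demands it of both summands.\<close>
  have "Poly_Mapping.keys (sum ?t A) \<subseteq> B \<and> P (sum ?t A)" if "finite A" "A \<subseteq> B" for A
    using that
  proof (induction A rule: finite_induct)
    case (insert a A)
    then show ?case
      using single[of a] keys_add[of "?t a" "sum ?t A"] add[of "?t a" "sum ?t A"] by auto
  qed (simp add: zero)
  then have "P (sum ?t (Poly_Mapping.keys p))" using p by simp
  also have "sum ?t (Poly_Mapping.keys p) = p"
    by (rule poly_mapping_eqI)
      (simp add: lookup_sum lookup_single when_def pm_scale_single in_keys_iff)
  finally show ?thesis .
qed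

section \<open>Grafting of trees and the operad axioms\<close>

lemma graft_lin_simps [simp]:
  "graft_lin i 0 q = 0" "graft_lin i p 0 = 0"
  "graft_lin i (p + p') q = graft_lin i p q + graft_lin i p' q"
  "graft_lin i p (q + q') = graft_lin i p q + graft_lin i p q'"
  "graft_lin i (pm_scale c p) q = pm_scale c (graft_lin i p q)"
  "graft_lin i p (pm_scale c q) = pm_scale c (graft_lin i p q)"
  "graft_lin i (Poly_Mapping.single t 1) (Poly_Mapping.single s 1) = Poly_Mapping.single (graft t i s) 1"
  by (simp_all add: graft_lin_def lin_ext_add lin_ext_scale lin_ext_fun_add lin_ext_fun_scale)

lemma size1_graft:
  "\<lbrakk>1 \<le> i; i \<le> size1 t\<rbrakk> \<Longrightarrow> size1 (graft t i s) = size1 t + size1 s - 1"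
proof (induction t i s rule: graft.induct)
  case (2 l x r i s)
  then show ?case using size1_ge0[of l] size1_ge0[of s] size1_ge0[of r] by auto
qed simp

text \<open>Leaf \<open>j\<close> of \<open>u\<close> becomes leaf \<open>i + j - 1\<close> after
  grafting, hence lies in the same subtree as the old leaf \<open>i\<close>; induction on the outer
  tree descends into that subtree.\<close>

lemma graft_sequential:
  "\<lbrakk>1 \<le> i; i \<le> size1 t; 1 \<le> j; j \<le> size1 u\<rbrakk> \<Longrightarrow>
    graft (graft t i u) (i + j - 1) s = graft t i (graft u j s)"
proof (induction t arbitrary: i)
  case (Node l x r)
  show ?case
  proof (cases "i \<le> size1 l")
    case True
    then have "i + j - 1 \<le> size1 (graft l i u)" using Node.prems by (simp add: size1_graft)
    with True show ?thesis using Node.IH(1)[of i] Node.prems by simp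
  next
    case False
    moreover from this have "i + j - 1 - size1 l = (i - size1 l) + j - 1" "\<not> i + j - 1 \<le> size1 l"
      using Node.prems by simp_all
    ultimately show ?thesis using Node.IH(2)[of "i - size1 l"] Node.prems by simp
  qed
qed simp

text \<open>Either both leaves lie in the same subtree, where induction applies, or the root
  separates them and the graftings act on different subtrees.\<close>

lemma graft_parallel:
  "\<lbrakk>1 \<le> i; i < k; k \<le> size1 t\<rbrakk> \<Longrightarrow>
    graft (graft t i u) (k + size1 u - 1) s = graft (graft t k s) i u"
proof (induction t arbitrary: i k)
  case (Node l x r)
  consider "k \<le> size1 l" | "i \<le> size1 l" "size1 l < k" | "size1 l < i" by linarith
  then show ?case
  proof cases
    case 1
    then have "i \<le> size1 (graft l k s)" "k + size1 u - 1 \<le> size1 (graft l i u)"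
      using Node.prems size1_ge0[of s] by (simp_all add: size1_graft)
    with 1 show ?thesis using Node.IH(1)[of i k] Node.prems by simp
  next
    case 2
    \<comment> \<open>Grafting on the left shifts \<open>k\<close> and the number of left leaves by
      the same amount, so the position within \<open>r\<close> is unchanged.\<close>
    moreover from this have "k + size1 u - 1 - (size1 l + size1 u - 1) = k - size1 l"
      "\<not> k + size1 u - 1 \<le> size1 l + size1 u - 1"
      using size1_ge0[of u] by linarith+
    ultimately show ?thesis using Node.prems by (simp add: size1_graft)
  next
    case 3
    moreover from this have "k + size1 u - 1 - size1 l = (k - size1 l) + size1 u - 1"
      "\<not> k + size1 u - 1 \<le> size1 l"
      using Node.prems by simp_all
    ultimately show ?thesis
      using Node.IH(2)[of "i - size1 l" "k - size1 l"] Node.prems by simp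
  qed
qed simp

lemma graft_Leaf_right: "graft t i Leaf = t"
  by (induction t arbitrary: i) auto

lemma keys_graft_lin:
  assumes "1 \<le> i" "i \<le> m" "Poly_Mapping.keys p \<subseteq> {t. size1 t = m}"
    and "Poly_Mapping.keys q \<subseteq> {t. size1 t = n}"
  shows "Poly_Mapping.keys (graft_lin i p q) \<subseteq> {t. size1 t = m + n - 1}"
  using assms(3)
proof (induction rule: free_vs_induct)
  case (basis t)
  show ?case using assms(4)
  proof (induction rule: free_vs_induct)
    case (basis s)
    then show ?case using \<open>t \<in> _\<close> assms(1,2) by (auto simp: size1_graft)
  next
    case (add q q')
    then show ?case using keys_add[of "graft_lin i (Poly_Mapping.single t 1) q"] by fastforce
  next
    case (scale c q)
    then show ?case using keys_pm_scale[of c "graft_lin i (Poly_Mapping.single t 1) q"] by auto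
  qed simp
next
  case (add p p')
  then show ?case using keys_add[of "graft_lin i p q"] by fastforce
next
  case (scale c p)
  then show ?case using keys_pm_scale[of c "graft_lin i p q"] by auto
qed simp

lemma free_operad_simps [simp]:
  "ar free_operad n = free_vs {t. size1 t = n}"
  "pcomp free_operad m n i = graft_lin i"
  "op_id free_operad = Poly_Mapping.single Leaf 1"
  by (simp_all add: free_operad_def)

lemma ns_operad_free_operad: "ns_operad class_ring (free_operad :: ('k::field, 'x tree \<Rightarrow>\<^sub>0 'k) nsop)"
proof (rule ns_operad.intro)
  let ?P = "free_operad :: ('k, 'x tree \<Rightarrow>\<^sub>0 'k) nsop"
  show "vectorspace class_ring (ar ?P n)" for n
    by (simp add: vectorspace_free_vs)
  show "op_id ?P \<in> carrier (ar ?P 1)"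
    by simp
  show "linear_map class_ring (ar ?P m) (ar ?P (m + n - 1)) (\<lambda>x. pcomp ?P m n i x y)"
    if "1 \<le> i" "i \<le> m" "y \<in> carrier (ar ?P n)" for i m y n
    using that keys_graft_lin[of i m _ y n]
    by (intro linear_mapI) (simp_all add: vectorspace_free_vs)
  show "linear_map class_ring (ar ?P n) (ar ?P (m + n - 1)) (\<lambda>y. pcomp ?P m n i x y)"
    if "1 \<le> i" "i \<le> m" "x \<in> carrier (ar ?P m)" for i m x n
    using that keys_graft_lin[of i m x _ n]
    by (intro linear_mapI) (simp_all add: vectorspace_free_vs)
  show "pcomp ?P (l + m - 1) n (i + j - 1) (pcomp ?P l m i x y) z =
      pcomp ?P l (m + n - 1) i x (pcomp ?P m n j y z)"
    if ij: "1 \<le> i" "i \<le> l" "1 \<le> j" "j \<le> m" and "x \<in> carrier (ar ?P l)"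
      and "y \<in> carrier (ar ?P m)" and "z \<in> carrier (ar ?P n)" for i l j m x y z n
  proof -
    have x: "Poly_Mapping.keys x \<subseteq> {t. size1 t = l}" and y: "Poly_Mapping.keys y \<subseteq> {t. size1 t = m}"
      and z: "Poly_Mapping.keys z \<subseteq> {t. size1 t = n}"
      using that by simp_all
    \<comment> \<open>Both sides are trilinear; three nested inductions leave the identity for
      trees.\<close>
    have "graft_lin (i + j - 1) (graft_lin i x y) z = graft_lin i x (graft_lin j y z)"
      using x
    proof (induction rule: free_vs_induct)
      case t: (basis t)
      show ?case using y
      proof (induction rule: free_vs_induct)
        case s: (basis s)
        show ?case using z
        proof (induction rule: free_vs_induct)
          case (basis u)
          then show ?case using graft_sequential[of i t j s u] ij t s by simp
        qed simp_all
      qed simp_all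
    qed simp_all
    then show ?thesis by simp
  qed
  show "pcomp ?P (l + m - 1) n (k + m - 1) (pcomp ?P l m i x y) z =
      pcomp ?P (l + n - 1) m i (pcomp ?P l n k x z) y"
    if ik: "1 \<le> i" "i < k" "k \<le> l" and "x \<in> carrier (ar ?P l)"
      and "y \<in> carrier (ar ?P m)" and "z \<in> carrier (ar ?P n)" for i k l x y m z n
  proof -
    have x: "Poly_Mapping.keys x \<subseteq> {t. size1 t = l}" and y: "Poly_Mapping.keys y \<subseteq> {t. size1 t = m}"
      and z: "Poly_Mapping.keys z \<subseteq> {t. size1 t = n}"
      using that by simp_all
    have "graft_lin (k + m - 1) (graft_lin i x y) z = graft_lin i (graft_lin k x z) y"
      using x
    proof (induction rule: free_vs_induct)
      case t: (basis t)
      show ?case using y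
      proof (induction rule: free_vs_induct)
        case s: (basis s)
        show ?case using z
        proof (induction rule: free_vs_induct)
          case (basis u)
          then show ?case using graft_parallel[of i k t s u] ik t s by simp
        qed simp_all
      qed simp_all
    qed simp_all
    then show ?thesis by simp
  qed
  show "pcomp ?P 1 n 1 (op_id ?P) x = x" if "x \<in> carrier (ar ?P n)" for x n
  proof -
    have "Poly_Mapping.keys x \<subseteq> {t. size1 t = n}" using that by simp
    then have "graft_lin 1 (Poly_Mapping.single Leaf 1) x = x"
      by (induction rule: free_vs_induct) simp_all
    then show ?thesis by simp
  qed
  show "pcomp ?P n 1 i x (op_id ?P) = x" if "x \<in> carrier (ar ?P n)" for i n x
  proof -
    have "Poly_Mapping.keys x \<subseteq> {t. size1 t = n}" using that by simp
    then have "graft_lin i x (Poly_Mapping.single Leaf 1) = x"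
      by (induction rule: free_vs_induct) (simp_all add: graft_Leaf_right)
    then show ?thesis by simp
  qed
qed

section \<open>Morphisms out of the free operad\<close>

text \<open>The uniqueness half of the universal property: a tree is an iterated composite of
  generators, and trees span each arity.\<close>

lemma free_operad_hom_eq:
  assumes g: "ns_operad_hom class_ring (free_operad :: ('k::field, 'x tree \<Rightarrow>\<^sub>0 'k) nsop) Q g"
    and h: "ns_operad_hom class_ring (free_operad :: ('k, 'x tree \<Rightarrow>\<^sub>0 'k) nsop) Q h"
    and gen: "\<And>x. g 2 (free_gen x) = h 2 (free_gen x)"
    and p: "p \<in> carrier (ar free_operad n)"
  shows "g n p = h n p"
proof -
  interpret g: ns_operad_hom class_ring "free_operad :: ('k, 'x tree \<Rightarrow>\<^sub>0 'k) nsop" Q g by fact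
  interpret h: ns_operad_hom class_ring "free_operad :: ('k, 'x tree \<Rightarrow>\<^sub>0 'k) nsop" Q h by fact
  have tree: "g (size1 t) (Poly_Mapping.single t 1) = h (size1 t) (Poly_Mapping.single t 1)" for t
  proof (induction t)
    case Leaf
    show ?case using g.hom_id h.hom_id by simp
  next
    case (Node l x r)
    let ?s = "\<lambda>t. Poly_Mapping.single t 1 :: 'x tree \<Rightarrow>\<^sub>0 'k"
    \<comment> \<open>A node is built from its generator by grafting \<open>r\<close> at leaf 2 and
      then \<open>l\<close> at leaf 1; in this order the position for \<open>l\<close> is not
      shifted.\<close>
    have inner: "f (1 + size1 r) (?s (Node Leaf x r)) = pcomp Q 2 (size1 r) 2 (f 2 (free_gen x)) (f (size1 r) (?s r))"
      if f: "ns_operad_hom class_ring (free_operad :: ('k, 'x tree \<Rightarrow>\<^sub>0 'k) nsop) Q f" for f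
    proof -
      have "f (2 + size1 r - 1) (graft_lin 2 (free_gen x) (?s r)) = pcomp Q 2 (size1 r) 2 (f 2 (free_gen x)) (f (size1 r) (?s r))"
        using ns_operad_hom.hom_pcomp[OF f, of 2 2 "free_gen x" "?s r" "size1 r"]
        unfolding free_operad_simps by (simp add: free_gen_def)
      moreover have "graft_lin 2 (free_gen x) (?s r) = ?s (Node Leaf x r)"
        by (simp add: free_gen_def)
      moreover have "2 + size1 r - 1 = 1 + size1 r" by simp
      ultimately show ?thesis by (simp only:)
    qed
    have outer: "f (size1 l + size1 r) (?s (Node l x r))
        = pcomp Q (1 + size1 r) (size1 l) 1 (f (1 + size1 r) (?s (Node Leaf x r))) (f (size1 l) (?s l))"
      if f: "ns_operad_hom class_ring (free_operad :: ('k, 'x tree \<Rightarrow>\<^sub>0 'k) nsop) Q f" for f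
    proof -
      have "f (1 + size1 r + size1 l - 1) (graft_lin 1 (?s (Node Leaf x r)) (?s l))
          = pcomp Q (1 + size1 r) (size1 l) 1 (f (1 + size1 r) (?s (Node Leaf x r))) (f (size1 l) (?s l))"
        using ns_operad_hom.hom_pcomp[OF f, of 1 "1 + size1 r" "?s (Node Leaf x r)" "?s l" "size1 l"]
        unfolding free_operad_simps by simp
      moreover have "graft_lin 1 (?s (Node Leaf x r)) (?s l) = ?s (Node l x r)"
        by simp
      moreover have "1 + size1 r + size1 l - 1 = size1 l + size1 r" by simp
      ultimately show ?thesis by (simp only:)
    qed
    show ?case
      by (simp only: size1.simps outer[OF g] outer[OF h] inner[OF g] inner[OF h] Node gen)
  qed
  interpret G: linear_map class_ring "free_vs {t :: 'x tree. size1 t = n}" "ar Q n" "g n"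
    using g.linear[of n] by simp
  interpret H: linear_map class_ring "free_vs {t :: 'x tree. size1 t = n}" "ar Q n" "h n"
    using h.linear[of n] by simp
  have "Poly_Mapping.keys p \<subseteq> {t. size1 t = n}" using p by simp
  then show ?thesis
  proof (induction rule: free_vs_induct)
    case zero
    show ?case using G.f0_is_0 H.f0_is_0 by simp
  next
    case (add p q)
    then show ?case using G.f_add[of p q] H.f_add[of p q] by simp
  next
    case (scale c p)
    then show ?case using G.f_smult[of c p] H.f_smult[of c p] by simp
  next
    case (basis t)
    then show ?case using tree[of t] by simp
  qed
qed


section \<open>Presented operads\<close>

lemma relations_ideal:
  fixes R :: "('x tree \<Rightarrow>\<^sub>0 'k::field) set"
  assumes "R \<subseteq> carrier (ar free_operad 3)"
  shows "operad_ideal class_ring free_operad (relations_ideal R)"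
    and "R \<subseteq> relations_ideal R 3"
proof -
  have "(if n = 3 then R else {}) \<subseteq> carrier (ar free_operad n)" for n :: nat
    using assms by (cases "n = 3") auto
  note ideal = ideal_generated_ideal[OF ns_operad_free_operad this]
  show "operad_ideal class_ring free_operad (relations_ideal R)"
    unfolding relations_ideal_def by (rule ideal(1))
  show "R \<subseteq> relations_ideal R 3"
    using ideal(2)[of 3] unfolding relations_ideal_def by simp
qed

text \<open>By minimality of the generated ideal, it suffices that the ideal of \<open>R'\<close>
  contains the generators \<open>R\<close>.\<close>

lemma relations_ideal_mono:
  fixes R R' :: "('x tree \<Rightarrow>\<^sub>0 'k::field) set"
  assumes "R' \<subseteq> carrier (ar free_operad 3)" "R \<subseteq> relations_ideal R' 3"
  shows "relations_ideal R n \<subseteq> relations_ideal R' n"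
  unfolding relations_ideal_def[of R]
proof (rule ideal_generated_least)
  show "operad_ideal class_ring free_operad (relations_ideal R')"
    using assms(1) by (rule relations_ideal)
  show "(if m = 3 then R else {}) \<subseteq> relations_ideal R' m" for m
    using assms(2) by simp
qed

lemma free_gen_closed: "free_gen x \<in> carrier (ar free_operad 2)"
  by (simp add: free_gen_def)

lemma presented_operad_hom_exists:
  fixes R R' :: "('x tree \<Rightarrow>\<^sub>0 'k::field) set"
  assumes "R \<subseteq> carrier (ar free_operad 3)" "R' \<subseteq> carrier (ar free_operad 3)"
    and "R \<subseteq> relations_ideal R' 3"
  shows "\<exists>h. ns_operad_hom class_ring (presented_operad R) (presented_operad R') h
    \<and> (\<forall>x. h 2 (presented_gen R x) = presented_gen R' x)
    \<and> operad_surjective (presented_operad R) (presented_operad R') h"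
proof -
  note mono = quot_operad_mono_hom[OF ns_operad_free_operad relations_ideal(1)[OF assms(1)]
      relations_ideal(1)[OF assms(2)] relations_ideal_mono[OF assms(2,3)]]
  show ?thesis
    unfolding presented_operad_def presented_gen_def
    by (intro exI conjI allI) (rule mono(1), rule mono(2)[OF free_gen_closed], rule mono(3))
qed

text \<open>Composing both morphisms with the surjective projection from the free operad reduces the
  claim to \<open>free_operad_hom_eq\<close>.\<close>

lemma presented_operad_hom_unique:
  fixes R :: "('x tree \<Rightarrow>\<^sub>0 'k::field) set"
  assumes R: "R \<subseteq> carrier (ar free_operad 3)"
    and g: "ns_operad_hom class_ring (presented_operad R) Q g"
    and h: "ns_operad_hom class_ring (presented_operad R) Q h"
    and gen: "\<And>x. g 2 (presented_gen R x) = h 2 (presented_gen R x)"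
    and X: "X \<in> carrier (ar (presented_operad R) n)"
  shows "g n X = h n X"
proof -
  let ?F = "free_operad :: ('k, 'x tree \<Rightarrow>\<^sub>0 'k) nsop"
  let ?\<pi> = "\<lambda>n x. relations_ideal R n +>\<^bsub>ar ?F n\<^esub> x"
  have proj: "ns_operad_hom class_ring ?F (presented_operad R) ?\<pi>"
    unfolding presented_operad_def
    using ns_operad_free_operad relations_ideal(1)[OF R] by (rule quot_operad_proj)
  have "?\<pi> n ` carrier (ar ?F n) = carrier (ar (presented_operad R) n)"
    using operad_surjective_quot[of ?F "relations_ideal R"]
    unfolding presented_operad_def operad_surjective_def by simp
  then obtain p where p: "p \<in> carrier (ar ?F n)" "X = ?\<pi> n p"
    using X by blast
  have "g n (?\<pi> n p) = h n (?\<pi> n p)"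
    using ns_operad_hom_comp[OF proj g] ns_operad_hom_comp[OF proj h] _ p(1)
    by (rule free_operad_hom_eq) (rule gen[unfolded presented_gen_def])
  then show ?thesis by (simp only: p(2))
qed

section \<open>The defining relations of the two operads\<close>

text \<open>A composite of two binary generators is a single tree with three leaves; both families
  of relations have this shape.\<close>

lemma quadratic_closed:
  fixes p q r s :: 'x
  assumes "i \<in> {1, 2}" "j \<in> {1, 2}"
  shows "graft_lin i (free_gen p) (free_gen q) - graft_lin j (free_gen r) (free_gen s)
    \<in> carrier (ar (free_operad :: ('k::field, 'x tree \<Rightarrow>\<^sub>0 'k) nsop) 3)"
proof -
  have "Poly_Mapping.keys (graft_lin k (free_gen a) (free_gen b :: 'x tree \<Rightarrow>\<^sub>0 'k)) \<subseteq> {t. size1 t = 3}"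
    if "k \<in> {1, 2}" for k and a b :: 'x
    using that by (auto simp: free_gen_def)
  then show ?thesis
    unfolding free_operad_simps free_vs_simps
    by (intro subset_trans[OF keys_diff] Un_least) (use assms in blast)+
qed

lemma As2_rels_closed: "As2_rels f \<subseteq> carrier (ar free_operad 3)"
  unfolding As2_rels_def by (auto simp del: free_operad_simps intro!: quadratic_closed)

lemma AsPhi_rels_linearization_closed:
  "AsPhi_rels (linearization E) \<subseteq> carrier (ar free_operad 3)"
  unfolding AsPhi_rels_linearization by (auto simp del: free_operad_simps intro!: quadratic_closed)

text \<open>The sign appears because \<open>As2_rels\<close> subtracts the composite at input 2 from
  the one at input 1, while \<open>AsPhi_rels\<close> subtracts in the other order.\<close>

lemma As2_rels_uminus_AsPhi_rels:
  fixes f :: "'w \<Rightarrow> 'w \<Rightarrow> 'w"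
  assumes "right_inverse_condition f"
  shows "uminus ` (As2_rels f :: (('w \<times> 'w) tree \<Rightarrow>\<^sub>0 'k::field) set)
    \<subseteq> AsPhi_rels (linearization (eas_prod (EAS f) (EAS' f)))"
proof -
  \<comment> \<open>This identifies the second operation applied to \<open>(a, f b c)\<close> and
    \<open>(b, c)\<close> as \<open>(a, b)\<close>.\<close>
  have "right_div f (f b c) c = b" for b c
    using assms by (rule right_div_eqI) (rule refl)
  then have "- (graft_lin 1 (free_gen (f a b, c)) (free_gen (a, b))
        - graft_lin 2 (free_gen (a, f b c)) (free_gen (b, c)) :: ('w \<times> 'w) tree \<Rightarrow>\<^sub>0 'k)
      \<in> AsPhi_rels (linearization (eas_prod (EAS f) (EAS' f)))" for a b c
    unfolding AsPhi_rels_linearization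
    by (intro CollectI exI[of _ "(a, f b c)"] exI[of _ "(b, c)"])
      (simp add: eas_prod_EAS_EAS'_simps del: graft_lin_simps)
  then show ?thesis
    unfolding As2_rels_def by (intro image_subsetI) (elim CollectE exE conjE, simp only:)
qed

section \<open>Existence, surjectivity and uniqueness of the morphism\<close>

theorem proposition3p15:
  fixes f :: "'w \<Rightarrow> 'w \<Rightarrow> 'w"
    and \<Omega>' :: "('w \<times> 'w) eas_ops"
    and \<Phi>' :: "(('w \<times> 'w) \<times> ('w \<times> 'w) \<Rightarrow>\<^sub>0 'k::field) \<Rightarrow> (('w \<times> 'w) \<times> ('w \<times> 'w) \<Rightarrow>\<^sub>0 'k)"
  assumes "semigroup f"
    and "right_inverse_condition f"
    and "\<Omega>' = eas_prod (EAS f) (EAS' f)"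
    and "\<Phi>' = linearization \<Omega>'"
  shows "\<exists>\<Theta>. ns_operad_hom (class_ring :: 'k ring) (As2 f) (AsPhi \<Phi>') \<Theta>
    \<and> (\<forall>\<alpha> \<beta>. \<Theta> 2 (As2_gen f (\<alpha>, \<beta>)) = AsPhi_gen \<Phi>' (\<alpha>, \<beta>))
    \<and> operad_surjective (As2 f) (AsPhi \<Phi>') \<Theta>
    \<and> (\<forall>\<Theta>'. ns_operad_hom (class_ring :: 'k ring) (As2 f) (AsPhi \<Phi>') \<Theta>'
          \<and> (\<forall>\<alpha> \<beta>. \<Theta>' 2 (As2_gen f (\<alpha>, \<beta>)) = AsPhi_gen \<Phi>' (\<alpha>, \<beta>))
        \<longrightarrow> (\<forall>n. \<forall>x\<in>carrier (ar (As2 f) n). \<Theta>' n x = \<Theta> n x))"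
proof -
  let ?R = "As2_rels f :: (('w \<times> 'w) tree \<Rightarrow>\<^sub>0 'k) set"
  have closed: "AsPhi_rels \<Phi>' \<subseteq> carrier (ar free_operad 3)"
    unfolding assms(4) by (rule AsPhi_rels_linearization_closed)
  note ideal = relations_ideal[OF closed]
  have sub: "?R \<subseteq> relations_ideal (AsPhi_rels \<Phi>') 3"
  proof
    fix r assume "r \<in> ?R"
    then have "- r \<in> relations_ideal (AsPhi_rels \<Phi>') 3"
      using As2_rels_uminus_AsPhi_rels[OF assms(2)] ideal(2) unfolding assms(3,4) by blast
    \<comment> \<open>The sign is removed inside the ideal, which is a subspace in each
      arity.\<close>
    then have "(- 1) \<odot>\<^bsub>ar free_operad 3\<^esub> (- r) \<in> relations_ideal (AsPhi_rels \<Phi>') 3"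
      by (intro submodule.smult_closed[OF subspace.submod[OF operad_idealD(1)[OF ideal(1)]]]) simp_all
    then show "r \<in> relations_ideal (AsPhi_rels \<Phi>') 3"
      by (simp add: pm_scale_minus_one)
  qed
  obtain \<Theta> where "ns_operad_hom class_ring (presented_operad ?R) (presented_operad (AsPhi_rels \<Phi>')) \<Theta>"
      "\<forall>p. \<Theta> 2 (presented_gen ?R p) = presented_gen (AsPhi_rels \<Phi>') p"
      "operad_surjective (presented_operad ?R) (presented_operad (AsPhi_rels \<Phi>')) \<Theta>"
    using presented_operad_hom_exists[OF As2_rels_closed closed sub] by (elim exE conjE)
  note \<Theta> = this[folded As2_def AsPhi_def As2_gen_def AsPhi_gen_def]
  \<comment> \<open>Agreement is asserted on carriers only, as a morphism is unconstrained outside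
    them.\<close>
  have unique: "\<Theta>' n x = \<Theta> n x"
    if \<Theta>': "ns_operad_hom (class_ring :: 'k ring) (As2 f) (AsPhi \<Phi>') \<Theta>'"
      "\<forall>\<alpha> \<beta>. \<Theta>' 2 (As2_gen f (\<alpha>, \<beta>)) = AsPhi_gen \<Phi>' (\<alpha>, \<beta>)"
      and x: "x \<in> carrier (ar (As2 f) n)" for \<Theta>' n x
  proof -
    have "\<Theta>' 2 (presented_gen ?R p) = \<Theta> 2 (presented_gen ?R p)" for p
      using \<Theta>(2) \<Theta>'(2) by (cases p) (simp add: As2_gen_def)
    then show ?thesis
      by (rule presented_operad_hom_unique[OF As2_rels_closed \<Theta>'(1)[unfolded As2_def]
          \<Theta>(1)[unfolded As2_def] _ x[unfolded As2_def]])
  qed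
  show ?thesis
  proof (intro exI[of _ \<Theta>] conjI allI impI ballI)
    show "\<Theta> 2 (As2_gen f (\<alpha>, \<beta>)) = AsPhi_gen \<Phi>' (\<alpha>, \<beta>)" for \<alpha> \<beta>
      using \<Theta>(2) by (rule spec)
  qed (rule \<Theta>(1), rule \<Theta>(3), elim conjE, rule unique)
qed

end
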